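(* Let $\mathcal H$ be a real Hilbert space, let $f\in\Gamma_0(\mathcal H)$ be real-valued with $\operatorname{lev}_{\leq 0}f\neq\varnothing$, and let $\phi:\mathbb R\to\mathbb R$ be strictly increasing on $f(\mathcal H)$ with $\phi(0)=0$. Suppose that $f$ is Fréchet differentiable on $\{x\in\mathcal H: f(x)>0\}$ and that $\phi$ is differentiable on $\mathbb R$. Then $\operatorname{dom}G_{\phi\circ f}=\mathcal H$ and $$G_{\phi\circ f}:\mathcal H\to\mathcal H:x\mapsto\begin{cases}x&\text{if }f(x)\leq 0,\\ x+\dfrac{\phi(f(x))}{f(x)\,\phi'(f(x))}\,(G_fx-x)&\text{if }f(x)>0.\end{cases}$$
   Context: $\Gamma_0(\mathcal H)$ is the set of proper convex lower semicontinuous functions $\mathcal H\to\,]-\infty,+\infty]$; $\operatorname{lev}_{\leq 0}f=\{x\in\mathcal H: f(x)\leq 0\}$; $\partial f$ is the convex subdifferential. For $f\in\Gamma_0(\mathcal H)$ with $\operatorname{lev}_{\leq 0}f\neq\varnothing$, the subgradient projector $G_f:\mathcal H\to 2^{\mathcal H}$ is $G_fx=\{x\}$ if $f(x)\leq 0$ and $G_fx=\{x-\frac{f(x)}{\|u\|^2}u : u\in\partial f(x)\}$ if $f(x)>0$ (subgradients at points where $f>0$ are nonzero because $\operatorname{lev}_{\leq 0}f\neq\varnothing$); $\operatorname{dom}G_f=\{x:G_fx\neq\varnothing\}$, and singletons are identified with their element. If $g$ is differentiable on $\{g>0\}$, then $G_g$ is the single-valued map $G_gx=x$ if $g(x)\leq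 0$ and $G_gx=x-\frac{g(x)}{\|\nabla g(x)\|^2}\nabla g(x)$ if $g(x)>0$; this is the expression meant by $G_{\phi\circ f}$, with $g=\phi\circ f$.
   Formalization: Where φ∘f>0 has zero gradient (φ'(f(x))=0, or f constant and negative with φ(f(x))>0), the projector and the displayed formula are undefined; there each quotient with zero denominator is read as 0, so that G_{φ∘f}x = x. *)

theory Defs
  imports "HOL-Analysis.Analysis"
begin

definition Gamma0 :: "('h::{real_inner, complete_space} \<Rightarrow> ereal) set" where
  "Gamma0 = {f. (\<forall>x. f x \<noteq> -\<infinity>) \<and> (\<exists>x. f x \<noteq> \<infinity>)
                \<and> convex {(x, r::real). f x \<le> ereal r}
                \<and> (\<forall>x. f x \<le> Liminf (at x) f)}"

definition subdifferential :: "('h::real_inner \<Rightarrow> ereal) \<Rightarrow> 'h \<Rightarrow> 'h set" where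
  "subdifferential f x = {u. \<forall>y. ereal ((y - x) \<bullet> u) + f x \<le> f y}"

(* Where a proper f takes the value \<infinity> its subdifferential is empty, so real_of_ereal is
   only ever applied to finite values here. *)
definition subgradient_projector :: "('h::real_inner \<Rightarrow> ereal) \<Rightarrow> 'h \<Rightarrow> 'h set" where
  "subgradient_projector f x =
     (if f x \<le> 0 then {x}
      else {x - (real_of_ereal (f x) / (norm u)\<^sup>2) *\<^sub>R u | u. u \<in> subdifferential f x})"

(* The projector of a function g that need not be convex, built from the gradient of g on
   {g > 0}. It is set-valued, so a point of {g > 0} where g has no gradient has empty image;
   where the gradient exists, its uniqueness makes the image a singleton. A vanishing gradient
   is not excluded: there the quotient is read with division by zero equal to zero, and the
   image is {x}. *)
definition gradient_projector :: "('h::real_inner \<Rightarrow> real) \<Rightarrow> 'h \<Rightarrow> 'h set" where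
  "gradient_projector g x =
     (if g x \<le> 0 then {x}
      else {x - (g x / (norm u)\<^sup>2) *\<^sub>R u | u. GDERIV g x :> u})"

definition projector_dom :: "('h \<Rightarrow> 'h set) \<Rightarrow> 'h set" where
  "projector_dom G = {x. G x \<noteq> {}}"

end

theory Submission
  imports Defs
begin

text \<open>
  Since \<open>f\<close> is convex, its gradient at a point of \<open>{f > 0}\<close> exists by Riesz representation and is
  the unique subgradient there, and the chain rule relates it to the gradient of \<open>\<phi> \<circ> f\<close>. What
  remains is that \<open>\<phi> \<circ> f\<close> and \<open>f\<close> have the same sign. If \<open>f\<close> takes a positive value, the
  intermediate value theorem along a segment puts \<open>0\<close> into the range of \<open>f\<close>, so that strict
  monotonicity can be compared with \<open>\<phi> 0 = 0\<close>. Otherwise \<open>f\<close> is bounded above, hence constant, and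
  although \<open>\<phi> \<circ> f\<close> may then be positive, its gradient vanishes.
\<close>

text \<open>Direct method: near-minimisers of a quadratic functional lie close together,
  completeness turns a minimising sequence into a minimiser, and the vanishing derivative there is
  the representation.\<close>

lemma riesz_representation:
  fixes L :: "'h::{real_inner, complete_space} \<Rightarrow> real"
  assumes "bounded_linear L"
  shows "\<exists>u. \<forall>h. L h = h \<bullet> u"
proof -
  interpret L: bounded_linear L by fact
  obtain K where K: "\<And>y. norm (L y) \<le> norm y * K"
    using L.bounded by blast
  \<comment> \<open>The representing vector is the minimiser of this functional.\<close>
  define J where "J y = (y \<bullet> y) / 2 - L y" for y
  define m where "m = Inf (range J)"
  \<comment> \<open>Completing the square in \<open>(norm y)\<^sup>2 / 2 - K * norm y\<close> gives
    this constant.\<close>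
  have "- (K\<^sup>2 / 2) \<le> J y" for y
  proof -
    have "L y \<le> norm y * K" using K[of y] by simp
    moreover have "0 \<le> (norm y - K)\<^sup>2" by simp
    ultimately show ?thesis
      unfolding J_def by (simp add: power2_eq_square algebra_simps flip: power2_norm_eq_inner)
  qed
  then have bdd: "bdd_below (range J)" by (auto simp: bdd_below_def)
  have m_le: "m \<le> J y" for y
    unfolding m_def using bdd by (auto intro: cInf_lower)
  have near: "\<exists>y. J y < m + e" if "e > 0" for e
    using cInf_lessD[of "range J" "m + e"] that unfolding m_def by auto
  \<comment> \<open>The linear part of \<open>J\<close> cancels between the endpoints and the
    midpoint, which leaves the parallelogram law; the midpoint value is at least
    \<open>m\<close>.\<close>
  have parallelogram: "(norm (a - b))\<^sup>2 \<le> 4 * (J a + J b - 2 * m)" for a b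
  proof -
    have "(norm (a - b))\<^sup>2 = 4 * (J a + J b - 2 * J ((1/2) *\<^sub>R (a + b)))"
      unfolding J_def power2_norm_eq_inner
      by (simp add: L.add L.scaleR algebra_simps inner_commute)
    with m_le[of "(1/2) *\<^sub>R (a + b)"] show ?thesis by simp
  qed
  obtain Y where Y: "\<And>n. J (Y n) < m + inverse (real (Suc n))"
    using choice[of "\<lambda>n y. J y < m + inverse (real (Suc n))"] near by force
  have "Cauchy Y"
  proof (rule metric_CauchyI)
    fix e :: real assume "e > 0"
    \<comment> \<open>Two values within \<open>e\<^sup>2 / 8\<close> of \<open>m\<close> bring the
      parallelogram bound below \<open>4 * (2 * (e\<^sup>2 / 8)) = e\<^sup>2\<close>.\<close>
    then obtain N where N: "inverse (real (Suc N)) < e\<^sup>2 / 8"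
      using reals_Archimedean[of "e\<^sup>2 / 8"] by auto
    have "dist (Y i) (Y j) < e" if "i \<ge> N" "j \<ge> N" for i j
    proof -
      have close: "J (Y k) < m + e\<^sup>2 / 8" if "k \<ge> N" for k
      proof -
        have "inverse (real (Suc k)) \<le> inverse (real (Suc N))"
          using that by (simp add: field_simps)
        with Y[of k] N show ?thesis by linarith
      qed
      have "(norm (Y i - Y j))\<^sup>2 < e\<^sup>2"
        using parallelogram[of "Y i" "Y j"] close[OF that(1)] close[OF that(2)] by argo
      then show ?thesis
        using \<open>e > 0\<close> by (simp add: dist_norm power2_less_imp_less)
    qed
    then show "\<exists>M. \<forall>i\<ge>M. \<forall>j\<ge>M. dist (Y i) (Y j) < e" by blast
  qed
  then obtain u where u: "Y \<longlonglongrightarrow> u"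
    using Cauchy_convergent convergent_def by blast
  have "(\<lambda>n. J (Y n)) \<longlonglongrightarrow> J u"
    unfolding J_def using u L.tendsto by (intro tendsto_intros) auto
  moreover have "(\<lambda>n. m + inverse (real (Suc n))) \<longlonglongrightarrow> m"
    using tendsto_add[OF tendsto_const LIMSEQ_inverse_real_of_nat] by simp
  ultimately have "J u \<le> m"
    by (rule LIMSEQ_le) (metis Y less_imp_le)
  then have "J u \<le> J y" for y
    using m_le order_trans by blast
  moreover have "(J has_derivative (\<lambda>h. h \<bullet> u - L h)) (at u)"
    unfolding J_def
    by (rule derivative_eq_intros L.has_derivative | simp add: inner_commute)+
  ultimately have "(\<lambda>h. h \<bullet> u - L h) = (\<lambda>h. 0)"
    by (intro has_derivative_local_min[of J]) auto
  then show ?thesis by (metis right_minus_eq)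
qed

lemma differentiable_imp_GDERIV:
  fixes f :: "'h::{real_inner, complete_space} \<Rightarrow> real"
  assumes "f differentiable (at x)"
  obtains u where "GDERIV f x :> u"
proof -
  obtain L where L: "(f has_derivative L) (at x)"
    using assms by (auto simp: differentiable_def)
  obtain u where "\<forall>h. L h = h \<bullet> u"
    using riesz_representation[OF has_derivative_bounded_linear[OF L]] by blast
  then have "L = (\<lambda>h. h \<bullet> u)" by auto
  with L that show thesis by (simp add: gderiv_def)
qed

text \<open>This is what makes the image under \<open>gradient_projector\<close> a
  singleton.\<close>

lemma GDERIV_unique:
  assumes "GDERIV f x :> u" "GDERIV f x :> v"
  shows "u = v"
proof -
  have "(\<lambda>h. h \<bullet> u) = (\<lambda>h. h \<bullet> v)"
    using assms unfolding gderiv_def by (rule has_derivative_unique)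
  then have "\<forall>h. h \<bullet> u = h \<bullet> v" by metis
  then show ?thesis by (metis vector_eq_ldot)
qed

text \<open>Reduction to one real variable, where convexity yields continuity and the tangent
  inequality.\<close>

lemma convex_on_line:
  fixes f :: "'a::real_vector \<Rightarrow> real"
  assumes "convex_on UNIV f"
  shows "convex_on UNIV (\<lambda>t. f (x + t *\<^sub>R d))"
proof (rule convex_onI)
  fix t a b :: real
  assume "0 < t" "t < 1"
  then have "f ((1 - t) *\<^sub>R (x + a *\<^sub>R d) + t *\<^sub>R (x + b *\<^sub>R d))
      \<le> (1 - t) * f (x + a *\<^sub>R d) + t * f (x + b *\<^sub>R d)"
    by (intro convex_onD[OF assms]) auto
  moreover have "(1 - t) *\<^sub>R (x + a *\<^sub>R d) + t *\<^sub>R (x + b *\<^sub>R d)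
      = x + ((1 - t) *\<^sub>R a + t *\<^sub>R b) *\<^sub>R d"
    by (simp add: algebra_simps)
  ultimately show "f (x + ((1 - t) *\<^sub>R a + t *\<^sub>R b) *\<^sub>R d)
      \<le> (1 - t) * f (x + a *\<^sub>R d) + t * f (x + b *\<^sub>R d)" by simp
qed simp

lemma convex_on_IVT:
  fixes f :: "'a::real_vector \<Rightarrow> real"
  assumes "convex_on UNIV f" "f x \<le> c" "c \<le> f y"
  shows "c \<in> range f"
proof -
  \<comment> \<open>Convexity on the whole real line gives continuity at the endpoints of the
    segment as well.\<close>
  have "continuous_on {0..1} (\<lambda>t. f (x + t *\<^sub>R (y - x)))"
    using convex_on_continuous[OF open_UNIV convex_on_line[OF assms(1)]]
    by (rule continuous_on_subset) auto
  then have "\<exists>t\<ge>0. t \<le> 1 \<and> f (x + t *\<^sub>R (y - x)) = c"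
    using assms by (intro IVT') auto
  then show ?thesis by auto
qed

text \<open>An increase from \<open>y\<close> to \<open>x\<close> would continue at least linearly
  along the ray beyond \<open>x\<close> and finally exceed \<open>B\<close>.\<close>

lemma convex_on_bounded_above_imp_constant:
  fixes f :: "'a::real_vector \<Rightarrow> real"
  assumes f: "convex_on UNIV f" and B: "\<And>z. f z \<le> B"
  shows "f x = f y"
proof -
  have le: "f x \<le> f y" for x y
  proof (rule ccontr)
    assume "\<not> f x \<le> f y"
    then have gt: "f x - f y > 0" by simp
    \<comment> \<open>\<open>x\<close> divides the segment from \<open>y\<close> to \<open>y + t (x - y)\<close> in the ratio \<open>1 : t - 1\<close>.\<close>
    define t where "t = max 1 ((B - f y) / (f x - f y) + 1)"
    define z where "z = y + t *\<^sub>R (x - y)"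
    have t: "t \<ge> 1" "t > (B - f y) / (f x - f y)" by (auto simp: t_def)
    have "(1 - 1/t) *\<^sub>R y + (1/t) *\<^sub>R z = x"
      using t(1) by (simp add: z_def algebra_simps)
    then have "f x \<le> (1 - 1/t) * f y + (1/t) * f z"
      using convex_onD[OF f, of "1/t" y z] t(1) by simp
    also have "\<dots> \<le> (1 - 1/t) * f y + (1/t) * B"
      using B[of z] t(1) by (intro add_left_mono mult_left_mono) auto
    finally have "t * (f x - f y) \<le> B - f y"
      using t(1) by (simp add: field_simps)
    with t(2) gt show False by (simp add: divide_less_eq)
  qed
  show ?thesis using le[of x y] le[of y x] by simp
qed

text \<open>A subgradient \<open>w\<close> makes \<open>f y - y \<bullet> w\<close> minimal at
  \<open>x\<close>, so its derivative \<open>u - w\<close> vanishes. Conversely, the tangent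
  inequality on the line through \<open>x\<close> and \<open>y\<close> makes \<open>u\<close> a
  subgradient.\<close>

lemma subdifferential_eq_gradient:
  fixes f :: "'h::real_inner \<Rightarrow> real"
  assumes f: "convex_on UNIV f" and u: "GDERIV f x :> u"
  shows "subdifferential (\<lambda>x. ereal (f x)) x = {u}"
proof (intro equalityI subsetI)
  fix w assume "w \<in> subdifferential (\<lambda>x. ereal (f x)) x"
  then have w: "(y - x) \<bullet> w + f x \<le> f y" for y
    by (auto simp: subdifferential_def)
  have "((\<lambda>y. f y - y \<bullet> w) has_derivative (\<lambda>h. h \<bullet> u - h \<bullet> w)) (at x)"
    using u unfolding gderiv_def by (auto intro!: derivative_eq_intros)
  then have "(\<lambda>h. h \<bullet> u - h \<bullet> w) = (\<lambda>h. 0)"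
    using w by (intro has_derivative_local_min) (auto simp: inner_diff_left algebra_simps)
  then have "\<forall>h. h \<bullet> u = h \<bullet> w" by (metis right_minus_eq)
  then show "w \<in> {u}" by (metis vector_eq_ldot singleton_iff)
next
  fix w assume "w \<in> {u}"
  have "(y - x) \<bullet> u + f x \<le> f y" for y
  proof -
    let ?g = "\<lambda>t. f (x + t *\<^sub>R (y - x))"
    have "(f has_derivative (\<lambda>h. h \<bullet> u)) (at (x + 0 *\<^sub>R (y - x)))"
      using u by (simp add: gderiv_def)
    moreover have "((\<lambda>t. x + t *\<^sub>R (y - x)) has_derivative (\<lambda>t. t *\<^sub>R (y - x))) (at 0)"
      by (auto intro!: derivative_eq_intros)
    ultimately have "(?g has_derivative (\<lambda>t. (t *\<^sub>R (y - x)) \<bullet> u)) (at 0)"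
      by (rule has_derivative_compose[rotated])
    then have "(?g has_field_derivative ((y - x) \<bullet> u)) (at 0)"
      by (simp add: has_field_derivative_def mult_commute_abs)
    then have "?g 1 - ?g 0 \<ge> ((y - x) \<bullet> u) * (1 - 0)"
      by (intro convex_on_imp_above_tangent[OF convex_on_line[OF f]]) auto
    then show ?thesis by simp
  qed
  with \<open>w \<in> {u}\<close> show "w \<in> subdifferential (\<lambda>x. ereal (f x)) x"
    by (auto simp: subdifferential_def)
qed

lemma subgradient_projector_eq:
  fixes f :: "'h::real_inner \<Rightarrow> real"
  assumes "convex_on UNIV f" "GDERIV f x :> u" "f x > 0"
  shows "subgradient_projector (\<lambda>x. ereal (f x)) x = {x - (f x / (norm u)\<^sup>2) *\<^sub>R u}"
  using assms by (simp add: subgradient_projector_def subdifferential_eq_gradient)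

lemma gradient_projector_eq:
  assumes "GDERIV g x :> u" "g x > 0"
  shows "gradient_projector g x = {x - (g x / (norm u)\<^sup>2) *\<^sub>R u}"
proof -
  have "GDERIV g x :> v \<longleftrightarrow> v = u" for v
    using assms(1) GDERIV_unique by blast
  with assms(2) show ?thesis by (simp add: gradient_projector_def)
qed

lemma Gamma0_imp_convex_on:
  assumes "(\<lambda>x. ereal (f x)) \<in> Gamma0"
  shows "convex_on UNIV f"
proof -
  have "epigraph UNIV f = {(x, r). ereal (f x) \<le> ereal r}"
    by (auto simp: epigraph_def)
  then show ?thesis
    using assms by (simp add: Gamma0_def flip: convex_epigraph)
qed

theorem proposition2p2:
  fixes f :: "'h::{real_inner, complete_space} \<Rightarrow> real"
    and \<phi> :: "real \<Rightarrow> real"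
  assumes "(\<lambda>x. ereal (f x)) \<in> Gamma0"
    and "{x. f x \<le> 0} \<noteq> {}"
    and "strict_mono_on (range f) \<phi>"
    and "\<phi> 0 = 0"
    and "\<And>x. f x > 0 \<Longrightarrow> f differentiable (at x)"
    and "\<And>t. \<phi> differentiable (at t)"
  shows "projector_dom (gradient_projector (\<phi> \<circ> f)) = UNIV
    \<and> (\<forall>x. \<exists>p. subgradient_projector (\<lambda>x. ereal (f x)) x = {p}
          \<and> gradient_projector (\<phi> \<circ> f) x =
              {if f x \<le> 0 then x
               else x + (\<phi> (f x) / (f x * deriv \<phi> (f x))) *\<^sub>R (p - x)})"
proof -
  have f: "convex_on UNIV f"
    using assms(1) by (rule Gamma0_imp_convex_on)
  obtain z where z: "f z \<le> 0" using assms(2) by auto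
  have *: "\<exists>p. subgradient_projector (\<lambda>x. ereal (f x)) x = {p}
          \<and> gradient_projector (\<phi> \<circ> f) x =
              {if f x \<le> 0 then x
               else x + (\<phi> (f x) / (f x * deriv \<phi> (f x))) *\<^sub>R (p - x)}" for x
  proof (cases "f x \<le> 0")
    case True
    have "gradient_projector (\<phi> \<circ> f) x = {x}"
    proof (cases "\<forall>y. f y \<le> 0")
      case True
      then have "(\<phi> \<circ> f) y = \<phi> (f x)" for y
        using convex_on_bounded_above_imp_constant[OF f, of 0 y x] by simp
      then have "\<phi> \<circ> f = (\<lambda>y. \<phi> (f x))" by (rule ext)
      then have "GDERIV (\<phi> \<circ> f) x :> 0" by (simp add: GDERIV_const)
      \<comment> \<open>Even if the constant value is positive, the displacement is a multiple of
        the zero gradient, so \<open>x\<close> stays fixed.\<close>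
      then show ?thesis
        using gradient_projector_eq[of "\<phi> \<circ> f" x 0]
        by (cases "(\<phi> \<circ> f) x \<le> 0") (auto simp: gradient_projector_def)
    next
      case False
      then obtain y where "f y \<ge> 0" using nle_le by blast
      then have "0 \<in> range f" using convex_on_IVT[OF f z] by blast
      then have "\<phi> (f x) \<le> \<phi> 0"
        using True strict_mono_on_leD[OF assms(3), of "f x" 0] by simp
      then show ?thesis by (simp add: gradient_projector_def assms(4))
    qed
    moreover have "subgradient_projector (\<lambda>x. ereal (f x)) x = {x}"
      using True by (simp add: subgradient_projector_def)
    ultimately show ?thesis using True by simp
  next
    case False
    then have pos: "f x > 0" by simp
    \<comment> \<open>Monotonicity is given only on \<open>range f\<close>, so \<open>0\<close> has
      to be a value of \<open>f\<close> before \<open>\<phi> 0\<close> can be compared with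
      \<open>\<phi> (f x)\<close>.\<close>
    then have "0 \<in> range f" using convex_on_IVT[OF f z, of x] by simp
    then have \<phi>_pos: "\<phi> (f x) > 0"
      using strict_mono_onD[OF assms(3), of 0 "f x"] pos assms(4) by simp
    obtain u where u: "GDERIV f x :> u"
      using assms(5)[OF pos] by (rule differentiable_imp_GDERIV)
    let ?d = "deriv \<phi> (f x)"
    have "(\<phi> has_field_derivative ?d) (at (f x))"
      using assms(6) by (metis DERIV_deriv_iff_real_differentiable)
    from GDERIV_DERIV_compose[OF u this] have "GDERIV (\<phi> \<circ> f) x :> ?d *\<^sub>R u"
      by (simp add: comp_def)
    then have "gradient_projector (\<phi> \<circ> f) x
        = {x - (\<phi> (f x) / (norm (?d *\<^sub>R u))\<^sup>2) *\<^sub>R ?d *\<^sub>R u}"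
      using gradient_projector_eq[of "\<phi> \<circ> f"] \<phi>_pos by simp
    moreover have "(\<phi> (f x) / (norm (?d *\<^sub>R u))\<^sup>2) *\<^sub>R ?d *\<^sub>R u
        = (\<phi> (f x) / (f x * ?d)) *\<^sub>R ((f x / (norm u)\<^sup>2) *\<^sub>R u)"
      \<comment> \<open>If \<open>?d = 0\<close>, both sides vanish because division by zero gives zero.\<close>
      using pos by (simp add: power_mult_distrib power2_eq_square[of ?d])
    \<comment> \<open>The vector \<open>(f x / (norm u)\<^sup>2) *\<^sub>R u\<close> is
      \<open>x - p\<close> for the projection \<open>p\<close>, so subtracting its multiple adds
      that multiple of \<open>p - x\<close>.\<close>
    ultimately show ?thesis
      using subgradient_projector_eq[OF f u pos] False by simp
  qed
  have "gradient_projector (\<phi> \<circ> f) x \<noteq> {}" for x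
    using *[of x] by force
  then have "projector_dom (gradient_projector (\<phi> \<circ> f)) = UNIV"
    by (simp add: projector_dom_def)
  with * show ?thesis by blast
qed

end
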